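(* Let $\{A(t)\}_{t\ge0}$ be a discrete time chain of $N\times N$ row-stochastic matrices. Then $\mathbf{rank}(A)$ is greater than or equal to the maximum number of disjoint jets $J$ in $\mathcal V=\{1,\dots,N\}$, each of which satisfies $U_{in}(J)<\infty$.
   Context: Time indices are non-negative integers; write $A(t)=(a_{ij}(t))$. The state transition matrix of the chain is $\Phi(t,\tau)=A(t-1)\cdots A(\tau)$ for $t>\tau\ge0$, and $\Phi(t,t)=I$. Rank: for $\tau\ge0$, $\mathbf{null}_\tau(A)=\{v\in\mathbb R^N:\lim_{t\to\infty}\Phi(t,\tau)v=\mathbf 0_N\}$, where $\mathbf 0_N$ is the zero vector. The dimension of this vector space is non-increasing in $\tau$, hence eventually constant. $\mathbf{nullity}(A)=\lim_{\tau\to\infty}\dim(\mathbf{null}_\tau(A))$ and $\mathbf{rank}(A)=N-\mathbf{nullity}(A)$. A jet $J$ in $\mathcal V$ is a sequence $\{J(t)\}_{t\ge0}$ of subsets of $\mathcal V$. Jets $J^1,\dots,J^d$ are disjoint if for every $t\ge0$ the sets $J^1(t),\dots,J^d(t)$ are pairwise disjoint. For a jet $J$, the total influence of its complement $\{\mathcal V\setminus J(t)\}$ on $J$ over the infinite time interval is $$U_{in}(J)=\sum_{t=0}^\infty\ \sum_{i\in J(t+1)}\ \sum_{j\notin J(t)}a_{ij}(t).$$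
   Formalization: Jets that are empty from some time on are excluded from the count; otherwise arbitrarily many disjoint empty jets with zero total influence exist and the maximum number of disjoint jets is undefined. *)

theory Defs
  imports "HOL-Analysis.Analysis"
begin

text \<open>
  Vertices are the elements of a finite type \<open>'n\<close>, so that \<open>N\<close> is \<open>CARD('n)\<close>.
  A chain is a sequence of square matrices indexed by \<open>'n\<close>.
\<close>

definition row_stochastic :: "real^'n^'n \<Rightarrow> bool" where
  "row_stochastic M \<longleftrightarrow> (\<forall>i j. 0 \<le> M $ i $ j) \<and> (\<forall>i. (\<Sum>j\<in>UNIV. M $ i $ j) = 1)"

text \<open>Only the values for \<open>\<tau> \<le> t\<close> matter; the others are set to the identity.\<close>

primrec state_transition :: "(nat \<Rightarrow> real^'n^'n) \<Rightarrow> nat \<Rightarrow> nat \<Rightarrow> real^'n^'n" where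
  "state_transition A 0 \<tau> = mat 1"
| "state_transition A (Suc t) \<tau> = (if \<tau> \<le> t then A t ** state_transition A t \<tau> else mat 1)"

definition null_from :: "(nat \<Rightarrow> real^'n^'n) \<Rightarrow> nat \<Rightarrow> (real^'n) set" where
  "null_from A \<tau> = {v. (\<lambda>t. state_transition A t \<tau> *v v) \<longlonglongrightarrow> 0}"

definition chain_nullity :: "(nat \<Rightarrow> real^'n^'n) \<Rightarrow> nat" where
  "chain_nullity A = lim (\<lambda>\<tau>. dim (null_from A \<tau>))"

definition chain_rank :: "(nat \<Rightarrow> real^'n^'n) \<Rightarrow> nat" where
  "chain_rank A = CARD('n) - chain_nullity A"

type_synonym 'n jet = "nat \<Rightarrow> 'n set"

definition jet_inflow :: "(nat \<Rightarrow> real^'n^'n) \<Rightarrow> 'n jet \<Rightarrow> ennreal" where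
  "jet_inflow A J = (\<Sum>t. ennreal (\<Sum>i\<in>J (Suc t). \<Sum>j\<in>- J t. A t $ i $ j))"

text \<open>
  A jet that is empty from some time on has finite inflow, and arbitrarily many copies of
  it are disjoint, so such jets have to be left out for the maximum below to exist.
  Being empty at some times is otherwise allowed. For row-stochastic chains, the
  maximum is the same if all the sets \<open>J t\<close> are required to be nonempty: finite inflow forces
  a jet to be nonempty at all late times, and changing finitely many sets keeps the inflow
  finite.
\<close>

definition eventually_empty :: "'n jet \<Rightarrow> bool" where
  "eventually_empty J \<longleftrightarrow> (\<forall>\<^sub>F t in sequentially. J t = {})"

definition disjoint_jets :: "nat \<Rightarrow> (nat \<Rightarrow> 'n jet) \<Rightarrow> bool" where
  "disjoint_jets d J \<longleftrightarrow> (\<forall>t. disjoint_family_on (\<lambda>k. J k t) {..<d})"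

definition finite_inflow_jet_counts :: "(nat \<Rightarrow> real^'n^'n) \<Rightarrow> nat set" where
  "finite_inflow_jet_counts A =
    {d. \<exists>J. disjoint_jets d J \<and>
            (\<forall>k<d. \<not> eventually_empty (J k) \<and> jet_inflow A (J k) < \<infinity>)}"

definition max_disjoint_jets :: "(nat \<Rightarrow> real^'n^'n) \<Rightarrow> nat" where
  "max_disjoint_jets A = Max (finite_inflow_jet_counts A)"


text \<open>The limit in \<^const>\<open>chain_nullity\<close> and the maximum in \<^const>\<open>max_disjoint_jets\<close> exist.\<close>

lemma state_transition_same [simp]: "state_transition A t t = mat 1"
  by (cases t) auto

lemma state_transition_unfold_right:
  "\<tau> < t \<Longrightarrow> state_transition A t \<tau> = state_transition A t (Suc \<tau>) ** A \<tau>"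
proof (induction t)
  case (Suc t)
  show ?case
  proof (cases "\<tau> = t")
    case False
    with Suc show ?thesis by (simp add: matrix_mul_assoc)
  qed simp
qed simp

lemma null_from_Suc: "null_from A \<tau> = {v. A \<tau> *v v \<in> null_from A (Suc \<tau>)}"
proof -
  have "(\<lambda>t. state_transition A t \<tau> *v v) \<longlonglongrightarrow> 0 \<longleftrightarrow>
        (\<lambda>t. state_transition A t (Suc \<tau>) *v (A \<tau> *v v)) \<longlonglongrightarrow> 0" for v
    by (intro filterlim_cong refl eventually_mono[OF eventually_gt_at_top[of \<tau>]])
       (simp add: state_transition_unfold_right matrix_vector_mul_assoc)
  then show ?thesis by (simp add: null_from_def)
qed

lemma subspace_null_from: "subspace (null_from A \<tau>)"
  unfolding subspace_def null_from_def
proof (intro conjI ballI allI)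
  fix x y assume "x \<in> {v. (\<lambda>t. state_transition A t \<tau> *v v) \<longlonglongrightarrow> 0}"
    and "y \<in> {v. (\<lambda>t. state_transition A t \<tau> *v v) \<longlonglongrightarrow> 0}"
  then show "x + y \<in> {v. (\<lambda>t. state_transition A t \<tau> *v v) \<longlonglongrightarrow> 0}"
    using tendsto_add[of "\<lambda>t. state_transition A t \<tau> *v x" 0 sequentially
        "\<lambda>t. state_transition A t \<tau> *v y" 0]
    by (simp add: matrix_vector_right_distrib)
next
  fix c :: real and x assume "x \<in> {v. (\<lambda>t. state_transition A t \<tau> *v v) \<longlonglongrightarrow> 0}"
  then show "c *\<^sub>R x \<in> {v. (\<lambda>t. state_transition A t \<tau> *v v) \<longlonglongrightarrow> 0}"
    using tendsto_scaleR[OF tendsto_const[of c], of "\<lambda>t. state_transition A t \<tau> *v x" 0 sequentially]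
    by (simp add: matrix_vector_mult_scaleR)
qed simp

lemma dim_le_dim_vimage:
  fixes M :: "real^'n^'n"
  assumes S: "subspace S"
  shows "dim S \<le> dim {v. M *v v \<in> S}"
proof -
  let ?P = "{y\<in>UNIV. \<forall>x\<in>S. orthogonal x y}"
  let ?T = "(*v) (transpose M) ` ?P"
  have P: "subspace ?P"
    using subspace_orthogonal_to_vectors[of S] by simp
  have T: "subspace ?T"
    by (rule linear_subspace_image[OF matrix_vector_mul_linear P])
  have dP: "dim ?P + dim S = CARD('n)"
    using dim_subspace_orthogonal_to_vectors[OF S subspace_UNIV subset_UNIV] by simp
  have dT: "dim {y\<in>UNIV. \<forall>x\<in>?T. orthogonal x y} + dim ?T = CARD('n)"
    using dim_subspace_orthogonal_to_vectors[OF T subspace_UNIV subset_UNIV] by simp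
  have "dim ?T \<le> dim ?P"
    by (rule dim_image_le[OF matrix_vector_mul_linear])
  moreover have "{y\<in>UNIV. \<forall>x\<in>?T. orthogonal x y} \<subseteq> {v. M *v v \<in> S}"
  proof
    fix y assume y: "y \<in> {y\<in>UNIV. \<forall>x\<in>?T. orthogonal x y}"
    have orth: "x \<bullet> (M *v y) = 0" if "x \<in> ?P" for x
    proof -
      have "orthogonal (transpose M *v x) y" using y that by blast
      then show ?thesis by (simp add: orthogonal_def dot_lmul_matrix[symmetric])
    qed
    obtain u w where u: "u \<in> span S" and w: "\<And>z. z \<in> span S \<Longrightarrow> orthogonal w z"
      and uw: "M *v y = u + w"
      using orthogonal_subspace_decomp_exists[of S "M *v y"] by blast
    have "w \<in> ?P"
      using w by (auto simp: span_base orthogonal_commute)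
    from orth[OF this] have "w \<bullet> (u + w) = 0" by (simp only: uw)
    moreover have "w \<bullet> u = 0" using w[OF u] by (simp only: orthogonal_def)
    ultimately have "w = 0" by (simp add: inner_right_distrib)
    with uw u show "y \<in> {v. M *v v \<in> S}" by (simp add: span_eq_iff[THEN iffD2, OF S])
  qed
  then have "dim {y\<in>UNIV. \<forall>x\<in>?T. orthogonal x y} \<le> dim {v. M *v v \<in> S}"
    by (rule dim_subset)
  ultimately show ?thesis using dP dT by linarith
qed

lemma decseq_dim_null_from: "decseq (\<lambda>\<tau>. dim (null_from A \<tau>))"
  by (rule decseq_SucI) (subst (2) null_from_Suc, rule dim_le_dim_vimage[OF subspace_null_from])

lemma eventually_dim_null_from:
  "\<forall>\<^sub>F \<tau> in sequentially. dim (null_from A \<tau>) = chain_nullity A"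
proof -
  let ?f = "\<lambda>\<tau>. dim (null_from A \<tau>)"
  obtain m where m: "\<And>k. ?f m \<le> ?f k"
    using ex_has_least_nat[of "\<lambda>_. True" 0 ?f] by auto
  have ev: "\<forall>\<^sub>F \<tau> in sequentially. ?f \<tau> = ?f m"
    using eventually_ge_at_top[of m]
    by eventually_elim (meson decseqD[OF decseq_dim_null_from] m antisym)
  then have "?f \<longlonglongrightarrow> ?f m" by (rule tendsto_eventually)
  then have "chain_nullity A = ?f m" unfolding chain_nullity_def by (rule limI)
  with ev show ?thesis by simp
qed

lemma eventually_nonempty_of_finite_inflow:
  fixes A :: "nat \<Rightarrow> real^'n^'n"
  assumes A: "\<And>t. row_stochastic (A t)"
    and fin: "jet_inflow A J < \<infinity>" and ne: "\<not> eventually_empty J"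
  shows "\<forall>\<^sub>F t in sequentially. J t \<noteq> {}"
proof -
  let ?f = "\<lambda>t. \<Sum>i\<in>J (Suc t). \<Sum>j\<in>- J t. A t $ i $ j"
  have nn: "0 \<le> A t $ i $ j" for t i j
    using A[of t] by (simp add: row_stochastic_def)
  have "summable ?f"
    using fin unfolding jet_inflow_def
    by (intro summable_suminf_not_top) (auto intro!: sum_nonneg nn)
  then have "?f \<longlonglongrightarrow> 0" by (rule summable_LIMSEQ_zero)
  then have "\<forall>\<^sub>F t in sequentially. ?f t < 1" by (rule order_tendstoD) simp
  then obtain T where T: "\<And>t. t \<ge> T \<Longrightarrow> ?f t < 1"
    by (auto simp: eventually_sequentially)
  have step: "J (Suc t) = {}" if "t \<ge> T" "J t = {}" for t
  proof -
    have "?f t = of_nat (card (J (Suc t)))"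
      using that A[of t] by (simp add: row_stochastic_def)
    with T[OF \<open>t \<ge> T\<close>] show ?thesis by simp
  qed
  have "J t \<noteq> {}" if "t \<ge> T" for t
  proof
    assume empty: "J t = {}"
    have "J s = {}" if "s \<ge> t" for s
      using that by (induction s rule: dec_induct) (use empty step \<open>t \<ge> T\<close> in auto)
    then show False
      using ne unfolding eventually_empty_def eventually_sequentially by blast
  qed
  then show ?thesis by (auto simp: eventually_sequentially)
qed

lemma finite_inflow_jet_counts_bounded:
  fixes A :: "nat \<Rightarrow> real^'n^'n"
  assumes A: "\<And>t. row_stochastic (A t)" and d: "d \<in> finite_inflow_jet_counts A"
  shows "d \<le> CARD('n)"
proof -
  from d obtain J where J: "disjoint_jets d J"
    "\<And>k. k < d \<Longrightarrow> \<not> eventually_empty (J k) \<and> jet_inflow A (J k) < \<infinity>"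
    by (auto simp: finite_inflow_jet_counts_def)
  have "\<forall>\<^sub>F t in sequentially. \<forall>k\<in>{..<d}. J k t \<noteq> {}"
    using J(2) by (intro eventually_ball_finite ballI eventually_nonempty_of_finite_inflow[of A, OF A]) auto
  then obtain t where t: "\<And>k. k < d \<Longrightarrow> J k t \<noteq> {}"
    by (auto simp: eventually_sequentially)
  have "\<exists>x. x \<in> J k t" if "k < d" for k using t[OF that] by auto
  then obtain g where g: "\<And>k. k < d \<Longrightarrow> g k \<in> J k t" by metis
  have "inj_on g {..<d}"
  proof (rule inj_onI)
    fix k l assume kl: "k \<in> {..<d}" "l \<in> {..<d}" "g k = g l"
    then have "g k \<in> J k t \<inter> J l t" using g[of k] g[of l] by auto
    then show "k = l"
      using J(1) kl unfolding disjoint_jets_def disjoint_family_on_def by blast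
  qed
  then show ?thesis using card_inj_on_le[of g "{..<d}" UNIV] by simp
qed

lemma finite_inflow_jet_counts_finite_nonempty:
  fixes A :: "nat \<Rightarrow> real^'n^'n"
  assumes "\<And>t. row_stochastic (A t)"
  shows "finite (finite_inflow_jet_counts A)" "finite_inflow_jet_counts A \<noteq> {}"
proof -
  have "finite_inflow_jet_counts A \<subseteq> {..CARD('n)}"
    using finite_inflow_jet_counts_bounded[OF assms] by auto
  then show "finite (finite_inflow_jet_counts A)" by (rule finite_subset) simp
  have "0 \<in> finite_inflow_jet_counts A"
    by (simp add: finite_inflow_jet_counts_def disjoint_jets_def disjoint_family_on_def)
  then show "finite_inflow_jet_counts A \<noteq> {}" by blast
qed

end

theory Submission
  imports Defs
begin

text \<open>
  If \<open>J\<close> has finite inflow, then for large \<open>\<tau>\<close> every row \<open>i \<in> J t\<close> of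
  \<open>\<Phi>(t, \<tau>)\<close> keeps all but a fraction \<open>1/4\<close> of its mass on the columns in \<open>J \<tau>\<close>,
  because the mass lost up to time \<open>t\<close> is at most the inflow accumulated since \<open>\<tau>\<close>.
  Given \<open>d\<close> disjoint such jets, let \<open>v\<close> be a combination of the indicator vectors of the sets
  \<open>J k \<tau>\<close>, and suppose that \<open>\<bar>v\<bar>\<close> attains its maximum \<open>c\<close> on \<open>J k \<tau>\<close>. Then
  \<open>\<Phi>(t, \<tau>) v\<close> has modulus at least \<open>c/2\<close> on \<open>J k t\<close>. Hence the \<open>d\<close>-dimensional span of
  the indicators meets the null space at \<open>\<tau>\<close> only in \<open>0\<close>, so the nullity is at most
  \<open>N - d\<close>.
\<close>

text \<open>The terms of the series in \<open>jet_inflow\<close>, kept real so that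
  \<open>summable\<close> and its Cauchy criterion apply.\<close>

definition inflow_at :: "(nat \<Rightarrow> real^'n^'n) \<Rightarrow> 'n jet \<Rightarrow> nat \<Rightarrow> real" where
  "inflow_at A J t = (\<Sum>i\<in>J (Suc t). \<Sum>j\<in>- J t. A t $ i $ j)"

lemma row_stochastic_nonneg: "row_stochastic M \<Longrightarrow> 0 \<le> M $ i $ j"
  by (simp add: row_stochastic_def)

lemma row_stochastic_sum: "row_stochastic M \<Longrightarrow> (\<Sum>j\<in>UNIV. M $ i $ j) = 1"
  by (simp add: row_stochastic_def)

lemma row_stochastic_sum_le: "row_stochastic M \<Longrightarrow> (\<Sum>j\<in>S. M $ i $ j) \<le> 1"
  using sum_mono2[of UNIV S "\<lambda>j. M $ i $ j"]
  by (simp add: row_stochastic_sum row_stochastic_nonneg)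

text \<open>Gives both closure under products (take \<open>S = UNIV\<close>) and the one-step
  recursion for the mass that a row of the transition matrix puts outside a jet.\<close>

lemma sum_matrix_mult_row:
  fixes M M' :: "real^'n^'n"
  shows "(\<Sum>j\<in>S. (M ** M') $ i $ j) = (\<Sum>k\<in>UNIV. M $ i $ k * (\<Sum>j\<in>S. M' $ k $ j))"
proof -
  have "(\<Sum>j\<in>S. (M ** M') $ i $ j) = (\<Sum>j\<in>S. \<Sum>k\<in>UNIV. M $ i $ k * M' $ k $ j)"
    by (simp add: matrix_matrix_mult_def)
  also have "\<dots> = (\<Sum>k\<in>UNIV. \<Sum>j\<in>S. M $ i $ k * M' $ k $ j)"
    by (rule sum.swap)
  finally show ?thesis by (simp add: sum_distrib_left)
qed

lemma row_stochastic_mat_1: "row_stochastic (mat 1)"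
  by (simp add: row_stochastic_def mat_def)

lemma row_stochastic_mult:
  assumes "row_stochastic M" "row_stochastic M'"
  shows "row_stochastic (M ** M')"
  unfolding row_stochastic_def
proof (intro conjI allI)
  show "0 \<le> (M ** M') $ i $ j" for i j
    using assms by (auto simp: matrix_matrix_mult_def row_stochastic_nonneg intro!: sum_nonneg)
  show "(\<Sum>j\<in>UNIV. (M ** M') $ i $ j) = 1" for i
    using assms by (simp add: sum_matrix_mult_row row_stochastic_sum)
qed

lemma row_stochastic_state_transition:
  assumes "\<And>t. row_stochastic (A t)"
  shows "row_stochastic (state_transition A t \<tau>)"
  by (induction t) (simp_all add: row_stochastic_mat_1 row_stochastic_mult assms)

lemma inflow_at_nonneg:
  assumes "\<And>t. row_stochastic (A t)"
  shows "0 \<le> inflow_at A J t"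
  unfolding inflow_at_def by (intro sum_nonneg row_stochastic_nonneg assms)

lemma summable_inflow_at:
  assumes "\<And>t. row_stochastic (A t)" and "jet_inflow A J < \<infinity>"
  shows "summable (inflow_at A J)"
  using assms(2) unfolding jet_inflow_def inflow_at_def[symmetric]
  by (intro summable_suminf_not_top) (auto intro: inflow_at_nonneg assms(1))

text \<open>Induction on \<open>t\<close>: row \<open>i\<close> at time \<open>t + 1\<close>
  averages the rows at time \<open>t\<close> with weights \<open>A t $ i $ k\<close>. Rows with
  \<open>k\<close> in \<open>J t\<close> obey the earlier bound; the others have outside mass at
  most 1 and total weight at most the inflow at time \<open>t\<close>.\<close>

lemma row_mass_outside_jet_le:
  fixes A :: "nat \<Rightarrow> real^'n^'n"
  assumes A: "\<And>t. row_stochastic (A t)" and "\<tau> \<le> t" and "i \<in> J t"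
  shows "(\<Sum>j\<in>- J \<tau>. state_transition A t \<tau> $ i $ j) \<le> (\<Sum>s=\<tau>..<t. inflow_at A J s)"
  using assms(2,3)
proof (induction t arbitrary: i rule: dec_induct)
  case base
  then show ?case by (auto simp: mat_def intro!: sum_nonpos)
next
  case (step t)
  define L where "L k = (\<Sum>j\<in>- J \<tau>. state_transition A t \<tau> $ k $ j)" for k
  define S where "S = (\<Sum>s=\<tau>..<t. inflow_at A J s)"
  have S0: "0 \<le> S" unfolding S_def by (intro sum_nonneg inflow_at_nonneg A)
  have L1: "L k \<le> 1" for k
    unfolding L_def by (rule row_stochastic_sum_le[OF row_stochastic_state_transition[OF A]])
  have LS: "L k \<le> S" if "k \<in> J t" for k
    unfolding L_def S_def using step.IH[OF that] .
  have a0: "0 \<le> A t $ i $ k" for k by (rule row_stochastic_nonneg[OF A])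
  have "(\<Sum>j\<in>- J \<tau>. state_transition A (Suc t) \<tau> $ i $ j) = (\<Sum>k\<in>UNIV. A t $ i $ k * L k)"
    using step.hyps by (simp add: sum_matrix_mult_row L_def)
  also have "\<dots> = (\<Sum>k\<in>J t. A t $ i $ k * L k) + (\<Sum>k\<in>- J t. A t $ i $ k * L k)"
    by (subst sum.union_disjoint[symmetric]) auto
  also have "(\<Sum>k\<in>J t. A t $ i $ k * L k) \<le> (\<Sum>k\<in>J t. A t $ i $ k) * S"
    by (simp add: sum_distrib_right sum_mono mult_left_mono LS a0)
  also have "\<dots> \<le> S"
    using mult_right_mono[OF row_stochastic_sum_le[OF A] S0] by simp
  also have "(\<Sum>k\<in>- J t. A t $ i $ k * L k) \<le> (\<Sum>k\<in>- J t. A t $ i $ k)"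
    by (intro sum_mono mult_left_le L1 a0)
  \<comment> \<open>Row \<open>i\<close> is one of the nonnegative summands, since \<open>i\<close>
    lies in \<open>J (Suc t)\<close>.\<close>
  also have "\<dots> \<le> inflow_at A J t"
    unfolding inflow_at_def using step.prems
    by (intro member_le_sum[where f = "\<lambda>i. \<Sum>k\<in>- J t. A t $ i $ k"] sum_nonneg
        row_stochastic_nonneg A) auto
  finally show ?case using step.hyps by (simp add: S_def)
qed

text \<open>As the row sums to 1, \<open>(M *v v) $ i - c\<close> is the average of the differences
  \<open>v $ j - c\<close>, which vanish on \<open>S\<close> and have modulus at most
  \<open>2 * \<bar>c\<bar>\<close> elsewhere.\<close>

lemma stochastic_row_concentrated_lower_bound:
  fixes M :: "real^'n^'n"
  assumes M: "row_stochastic M"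
    and c: "\<And>j. j \<in> S \<Longrightarrow> v $ j = c" and le: "\<And>j. \<bar>v $ j\<bar> \<le> \<bar>c\<bar>"
  shows "\<bar>c\<bar> * (1 - 2 * (\<Sum>j\<in>- S. M $ i $ j)) \<le> \<bar>(M *v v) $ i\<bar>"
proof -
  let ?L = "\<Sum>j\<in>- S. M $ i $ j"
  have "(M *v v) $ i - c = (\<Sum>j\<in>UNIV. M $ i $ j * v $ j) - (\<Sum>j\<in>UNIV. M $ i $ j) * c"
    by (simp add: matrix_vector_mult_def row_stochastic_sum[OF M])
  also have "\<dots> = (\<Sum>j\<in>UNIV. M $ i $ j * (v $ j - c))"
    by (simp add: sum_distrib_right sum_subtractf right_diff_distrib)
  also have "\<dots> = (\<Sum>j\<in>- S. M $ i $ j * (v $ j - c))"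
    by (rule sum.mono_neutral_right) (auto simp: c)
  also have "\<bar>\<dots>\<bar> \<le> (\<Sum>j\<in>- S. \<bar>M $ i $ j * (v $ j - c)\<bar>)"
    by (rule sum_abs)
  also have "\<dots> \<le> (\<Sum>j\<in>- S. M $ i $ j * (2 * \<bar>c\<bar>))"
  proof (intro sum_mono)
    fix j
    have "\<bar>v $ j - c\<bar> \<le> 2 * \<bar>c\<bar>" using le[of j] by linarith
    then show "\<bar>M $ i $ j * (v $ j - c)\<bar> \<le> M $ i $ j * (2 * \<bar>c\<bar>)"
      by (simp add: abs_mult row_stochastic_nonneg[OF M] mult_left_mono)
  qed
  also have "\<dots> = ?L * (2 * \<bar>c\<bar>)"
    by (simp add: sum_distrib_right)
  finally have "\<bar>(M *v v) $ i - c\<bar> \<le> ?L * (2 * \<bar>c\<bar>)" .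
  then show ?thesis by (simp add: algebra_simps)
qed

lemma null_from_max_on_jet_eq_0:
  fixes A :: "nat \<Rightarrow> real^'n^'n"
  assumes A: "\<And>t. row_stochastic (A t)" and v: "v \<in> null_from A \<tau>"
    and inflow: "\<And>t. (\<Sum>s=\<tau>..<t. inflow_at A J s) < 1/4"
    and ne: "\<And>t. \<tau> \<le> t \<Longrightarrow> J t \<noteq> {}"
    and c: "\<And>j. j \<in> J \<tau> \<Longrightarrow> v $ j = c" and le: "\<And>j. \<bar>v $ j\<bar> \<le> \<bar>c\<bar>"
  shows "c = 0"
proof -
  have bound: "\<bar>c\<bar> / 2 \<le> norm (state_transition A t \<tau> *v v)" if t: "\<tau> \<le> t" for t
  proof -
    obtain i where i: "i \<in> J t" using ne[OF t] by auto
    \<comment> \<open>Outside mass below 1/4 leaves a factor of at least 1/2, whatever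
      \<open>t\<close> is.\<close>
    have "1/2 \<le> 1 - 2 * (\<Sum>j\<in>- J \<tau>. state_transition A t \<tau> $ i $ j)"
      using row_mass_outside_jet_le[of A, OF A t, of i J] i inflow[of t] by linarith
    from mult_left_mono[OF this, of "\<bar>c\<bar>"]
    have "\<bar>c\<bar> / 2 \<le> \<bar>c\<bar> * (1 - 2 * (\<Sum>j\<in>- J \<tau>. state_transition A t \<tau> $ i $ j))"
      by simp
    also have "\<dots> \<le> \<bar>(state_transition A t \<tau> *v v) $ i\<bar>"
      by (rule stochastic_row_concentrated_lower_bound
          [OF row_stochastic_state_transition[OF A] c le])
    also have "\<dots> \<le> norm (state_transition A t \<tau> *v v)"
      by (rule component_le_norm_cart)
    finally show ?thesis .
  qed
  have "(\<lambda>t. norm (state_transition A t \<tau> *v v)) \<longlonglongrightarrow> 0"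
    using v by (simp add: null_from_def tendsto_norm_zero)
  then have "\<bar>c\<bar> / 2 \<le> 0"
    by (rule LIMSEQ_le_const) (use bound in blast)
  then show ?thesis by simp
qed

text \<open>The Cauchy criterion bounds all finite blocks from \<tau> on, so a single \<tau> serves
  every later \<open>t\<close>.\<close>

lemma eventually_inflow_tail_small:
  assumes "\<And>t. row_stochastic (A t)" and "jet_inflow A J < \<infinity>" and "0 < e"
  shows "\<forall>\<^sub>F \<tau> in sequentially. \<forall>t. (\<Sum>s=\<tau>..<t. inflow_at A J s) < e"
proof -
  obtain T where T: "\<And>\<tau> t. T \<le> \<tau> \<Longrightarrow> norm (\<Sum>s=\<tau>..<t. inflow_at A J s) < e"
    using summable_inflow_at[OF assms(1,2)] assms(3) unfolding summable_Cauchy by blast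
  have "(\<Sum>s=\<tau>..<t. inflow_at A J s) < e" if "T \<le> \<tau>" for \<tau> t
    using T[OF that, of t] by simp
  then show ?thesis by (auto simp: eventually_sequentially)
qed

text \<open>Two indicator vectors have the size of the intersection as inner product, so these are
  nonzero and pairwise orthogonal, hence independent.\<close>

lemma dim_span_indicators:
  fixes S :: "nat \<Rightarrow> 'n::finite set"
  assumes disj: "disjoint_family_on S {..<d}" and ne: "\<And>k. k < d \<Longrightarrow> S k \<noteq> {}"
  shows "dim (span ((\<lambda>k. (\<chi> i. indicator (S k) i) :: real^'n) ` {..<d})) = d"
proof -
  let ?e = "\<lambda>k. (\<chi> i. indicator (S k) i) :: real^'n"
  have inner: "?e k \<bullet> ?e l = card (S k \<inter> S l)" for k l
    by (simp add: inner_vec_def indicator_inter_arith[symmetric] indicator_def)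
  have orth: "?e k \<bullet> ?e l = 0" if "k < d" "l < d" "k \<noteq> l" for k l
    using disj that by (simp add: inner disjoint_family_on_def)
  have pos: "?e k \<bullet> ?e k \<noteq> 0" if "k < d" for k
    using ne[OF that] by (simp add: inner)
  have inj: "inj_on ?e {..<d}"
  proof (rule inj_onI)
    fix k l assume kl: "k \<in> {..<d}" "l \<in> {..<d}" and eq: "?e k = ?e l"
    show "k = l"
      using orth[of k l] pos[of k] kl unfolding eq by auto
  qed
  have "independent (?e ` {..<d})"
  proof (rule pairwise_orthogonal_independent)
    show "pairwise orthogonal (?e ` {..<d})"
      by (rule pairwise_imageI) (simp add: orthogonal_def orth)
    show "0 \<notin> ?e ` {..<d}"
      using pos by (metis (no_types, lifting) imageE inner_zero_left lessThan_iff)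
  qed
  then show ?thesis
    by (simp add: dim_span dim_eq_card_independent card_image[OF inj])
qed

lemma finite_inflow_jet_counts_le_rank:
  fixes A :: "nat \<Rightarrow> real^'n^'n"
  assumes A: "\<And>t. row_stochastic (A t)" and d: "d \<in> finite_inflow_jet_counts A"
  shows "d \<le> chain_rank A"
proof -
  from d obtain J where disj: "disjoint_jets d J"
    and J: "\<And>k. k < d \<Longrightarrow> \<not> eventually_empty (J k) \<and> jet_inflow A (J k) < \<infinity>"
    by (auto simp: finite_inflow_jet_counts_def)
  have "\<forall>\<^sub>F \<tau> in sequentially. \<forall>k\<in>{..<d}. \<forall>t\<ge>\<tau>. J k t \<noteq> {}"
    using J by (intro eventually_ball_finite ballI eventually_all_ge_at_top
        eventually_nonempty_of_finite_inflow[of A, OF A]) auto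
  moreover have "\<forall>\<^sub>F \<tau> in sequentially.
      \<forall>k\<in>{..<d}. \<forall>t. (\<Sum>s=\<tau>..<t. inflow_at A (J k) s) < 1/4"
    using J by (intro eventually_ball_finite ballI eventually_inflow_tail_small A) auto
  \<comment> \<open>All requirements hold at one common \<tau>, late enough for the null space to
    have its limiting dimension.\<close>
  ultimately have "\<forall>\<^sub>F \<tau> in sequentially. (\<forall>k\<in>{..<d}. \<forall>t\<ge>\<tau>. J k t \<noteq> {}) \<and>
      (\<forall>k\<in>{..<d}. \<forall>t. (\<Sum>s=\<tau>..<t. inflow_at A (J k) s) < 1/4) \<and>
      dim (null_from A \<tau>) = chain_nullity A"
    using eventually_dim_null_from by eventually_elim blast
  then obtain \<tau> where ne: "\<And>k t. k < d \<Longrightarrow> \<tau> \<le> t \<Longrightarrow> J k t \<noteq> {}"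
    and small: "\<And>k t. k < d \<Longrightarrow> (\<Sum>s=\<tau>..<t. inflow_at A (J k) s) < 1/4"
    and nullity: "dim (null_from A \<tau>) = chain_nullity A"
    by (force simp: eventually_sequentially)
  have disj': "disjoint_family_on (\<lambda>k. J k \<tau>) {..<d}"
    using disj by (simp add: disjoint_jets_def)
  let ?e = "\<lambda>k. (\<chi> i. indicator (J k \<tau>) i) :: real^'n"
  let ?V = "span (?e ` {..<d})"
  \<comment> \<open>A superspace of the span that exposes the two facts needed about its vectors
    without handling coefficients: constancy on each jet set and vanishing outside their
    union.\<close>
  let ?W = "{v :: real^'n. (\<forall>k<d. \<forall>i\<in>J k \<tau>. \<forall>j\<in>J k \<tau>. v $ i = v $ j) \<and>
                 (\<forall>i. (\<forall>k<d. i \<notin> J k \<tau>) \<longrightarrow> v $ i = 0)}"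
  have "?V \<subseteq> ?W"
  proof (rule span_minimal)
    have "?e l $ i = ?e l $ j" if "l < d" "k < d" "i \<in> J k \<tau>" "j \<in> J k \<tau>" for k l i j
      using disj' that by (cases "k = l") (auto simp: disjoint_family_on_def indicator_def)
    moreover have "?e l $ i = 0" if "l < d" "\<forall>k<d. i \<notin> J k \<tau>" for l i
      using that by simp
    ultimately show "?e ` {..<d} \<subseteq> ?W" by blast
    show "subspace ?W"
    proof (rule subspaceI)
      show "0 \<in> ?W" by simp
    next
      fix x y assume "x \<in> ?W" "y \<in> ?W"
      then show "x + y \<in> ?W"
        unfolding mem_Collect_eq vector_add_component by (metis add.right_neutral)
    next
      fix c x assume "x \<in> ?W"
      then show "c *\<^sub>R x \<in> ?W"
        unfolding mem_Collect_eq vector_scaleR_component by (metis scaleR_zero_right)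
    qed
  qed
  have "v = 0" if "v \<in> ?V \<inter> null_from A \<tau>" for v
  proof (rule ccontr)
    assume "v \<noteq> 0"
    then obtain j where j: "v $ j \<noteq> 0" by (auto simp: vec_eq_iff)
    \<comment> \<open>Choose a coordinate of maximal modulus. It is nonzero, so it lies in some jet
      set at time \<tau>.\<close>
    have "Max (range (\<lambda>i. \<bar>v $ i\<bar>)) \<in> range (\<lambda>i. \<bar>v $ i\<bar>)"
      by (intro Max_in) auto
    then obtain i where "Max (range (\<lambda>i. \<bar>v $ i\<bar>)) = \<bar>v $ i\<bar>" by (rule imageE)
    then have i: "\<bar>v $ j\<bar> \<le> \<bar>v $ i\<bar>" for j
      using Max_ge[of "range (\<lambda>i. \<bar>v $ i\<bar>)" "\<bar>v $ j\<bar>"] by simp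
    have W: "v \<in> ?W" using that \<open>?V \<subseteq> ?W\<close> by blast
    have "v $ i \<noteq> 0" using i[of j] j by auto
    then obtain k where k: "k < d" "i \<in> J k \<tau>" using W by blast
    have "v $ i = 0"
    proof (rule null_from_max_on_jet_eq_0[where A = A and \<tau> = \<tau> and J = "J k" and v = v])
      show "v $ j = v $ i" if "j \<in> J k \<tau>" for j
        using W k that by blast
      show "v \<in> null_from A \<tau>" using that by (rule IntD2)
    qed (rule A small ne k(1) i | assumption)+
    with \<open>v $ i \<noteq> 0\<close> show False ..
  qed
  then have "?V \<inter> null_from A \<tau> \<subseteq> {0}" by blast
  then have "dim (?V \<inter> null_from A \<tau>) = 0" by (simp add: dim_eq_0)
  moreover have "dim ?V = d"
    by (rule dim_span_indicators[OF disj']) (simp add: ne)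
  moreover have "dim {x + y |x y. x \<in> ?V \<and> y \<in> null_from A \<tau>} \<le> CARD('n)"
    using dim_subset_UNIV[of "{x + y |x y. x \<in> ?V \<and> y \<in> null_from A \<tau>}"]
    unfolding DIM_cart DIM_real mult_1_right .
  \<comment> \<open>Dimension formula for the sum of two subspaces that meet only in 0.\<close>
  ultimately have "d + chain_nullity A \<le> CARD('n)"
    using dim_sums_Int[OF subspace_span subspace_null_from, of "?e ` {..<d}" A \<tau>] nullity
    by linarith
  \<comment> \<open>The additive bound is what truncated subtraction in \<open>chain_rank\<close>
    requires.\<close>
  then show ?thesis by (simp add: chain_rank_def)
qed

theorem theorem10:
  fixes A :: "nat \<Rightarrow> real^'n^'n"
  assumes "\<And>t. row_stochastic (A t)"
  shows "chain_rank A \<ge> max_disjoint_jets A"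
  unfolding max_disjoint_jets_def
  \<comment> \<open>The set of counts is finite and nonempty, so its maximum is itself a
    count.\<close>
  by (rule finite_inflow_jet_counts_le_rank[OF assms])
     (intro Max_in finite_inflow_jet_counts_finite_nonempty assms)

end
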